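(* Let $s\ge1/2$, let $\mathcal{G}(g,\Lambda)$ be a Gabor frame for $L^2(\mathbb{R}^d)$ with $g\in S^s_s(\mathbb{R}^d)$, and let $\sigma^w$ be a Weyl operator whose Gabor matrix satisfies, for some constants $C_0>0$, $\epsilon_0>0$, $$|\langle\sigma^w\pi(\mu)g,\pi(\lambda)g\rangle|\le C_0\exp\big(-\epsilon_0|\lambda-\mu|^{1/s}\big)\qquad\text{for all }\lambda,\mu\in\Lambda.$$ Then the Gabor matrix is sparse in the following sense. Let $a$ be any column or row of the matrix $\big(\langle\sigma^w\pi(\mu)g,\pi(\lambda)g\rangle\big)_{\lambda,\mu\in\Lambda}$, and let $|a|_n$ be the $n$-th largest entry (in modulus) of the sequence $a$. Then $$|a|_n\le C\exp\big(-\epsilon n^{1/(2ds)}\big),\qquad n=1,2,\dots,$$ for some constants $C>0$, $\epsilon>0$.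
   Context: For $z=(x,\xi)\in\mathbb{R}^{2d}$, $\pi(z)f(t)=e^{2\pi i\xi\cdot t}f(t-x)$. For a lattice $\Lambda=A\mathbb{Z}^{2d}$, $A\in GL(2d,\mathbb{R})$, and $0\neq g\in L^2(\mathbb{R}^d)$, $\mathcal{G}(g,\Lambda)=\{\pi(\lambda)g:\lambda\in\Lambda\}$ is a Gabor frame if there are $A,B>0$ with $A\|f\|_2^2\le\sum_{\lambda\in\Lambda}|\langle f,\pi(\lambda)g\rangle|^2\le B\|f\|_2^2$ for all $f\in L^2(\mathbb{R}^d)$. $S^s_s(\mathbb{R}^d)$ is the Gelfand-Shilov space of $f\in\mathcal{S}(\mathbb{R}^d)$ such that for some $A,B,c>0$, $|x^\alpha\partial^\beta f(x)|\le cA^{|\alpha|}B^{|\beta|}(\alpha!)^s(\beta!)^s$ for all $x,\alpha,\beta$; $(S^s_s)'$ is its dual. Weyl operator $\sigma^w$ with symbol $\sigma\in(S^s_s)'(\mathbb{R}^{2d})$: the continuous map $S^s_s(\mathbb{R}^d)\to(S^s_s)'(\mathbb{R}^d)$ given formally by $\sigma^wf(x)=\int\int\sigma\big(\tfrac{x+y}{2},\xi\big)e^{2\pi i(x-y)\cdot\xi}f(y)\,dy\,d\xi$ and rigorously by $\langle\sigma^wf,h\rangle=\langle\sigma,W(h,f)\rangle$, where $W(f,h)(x,\xi)=\int_{\mathbb{R}^d}f(x+\tfrac t2)\overline{h(x-\tfrac t2)}e^{-2\pi it\cdot\xi}\,dt$ and brackets extend $\langle f,h\rangle=\int f\overline h$.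 Here $|a|_1\ge|a|_2\ge\cdots$ is the non-increasing rearrangement of the moduli of the entries of $a$. *)

theory Defs
  imports "HOL-Analysis.Analysis"
begin

text \<open>Multi-indices on a Euclidean space are functions \<open>\<alpha> :: 'a \<Rightarrow> nat\<close> of which only the
  values on \<^const>\<open>Basis\<close> matter. All integrals are with respect to Lebesgue measure.\<close>

definition mi_abs :: "('a::euclidean_space \<Rightarrow> nat) \<Rightarrow> nat"
  where "mi_abs \<alpha> = (\<Sum>b\<in>Basis. \<alpha> b)"

definition mi_fact :: "('a::euclidean_space \<Rightarrow> nat) \<Rightarrow> real"
  where "mi_fact \<alpha> = (\<Prod>b\<in>Basis. fact (\<alpha> b))"

definition mi_power :: "'a::euclidean_space \<Rightarrow> ('a \<Rightarrow> nat) \<Rightarrow> real"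
  where "mi_power x \<alpha> = (\<Prod>b\<in>Basis. (x \<bullet> b) ^ \<alpha> b)"

definition partial_deriv :: "'a::euclidean_space \<Rightarrow> ('a \<Rightarrow> complex) \<Rightarrow> 'a \<Rightarrow> complex"
  where "partial_deriv b f x = vector_derivative (\<lambda>t. f (x + t *\<^sub>R b)) (at 0)"

definition iterated_partial :: "'a::euclidean_space list \<Rightarrow> ('a \<Rightarrow> complex) \<Rightarrow> 'a \<Rightarrow> complex"
  where "iterated_partial bs f = foldr partial_deriv bs f"

text \<open>If all iterated partial derivatives are (totally) differentiable, they are all continuous;
  so this is membership in \<open>C\<^sup>\<infinity>\<close>.\<close>

definition smooth :: "('a::euclidean_space \<Rightarrow> complex) \<Rightarrow> bool"
  where "smooth f \<longleftrightarrow> (\<forall>bs\<in>lists Basis. \<forall>x. iterated_partial bs f differentiable (at x))"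

text \<open>\<open>\<partial>\<^sup>\<beta> f\<close>; the derivatives are taken in some order, which is immaterial for smooth \<open>f\<close>.\<close>

definition mi_deriv :: "('a::euclidean_space \<Rightarrow> nat) \<Rightarrow> ('a \<Rightarrow> complex) \<Rightarrow> 'a \<Rightarrow> complex"
  where "mi_deriv \<beta> f =
    iterated_partial (SOME bs. set bs \<subseteq> Basis \<and> (\<forall>b\<in>Basis. count_list bs b = \<beta> b)) f"

definition schwartz :: "('a::euclidean_space \<Rightarrow> complex) set"
  where "schwartz = {f. smooth f \<and>
    (\<forall>\<alpha> \<beta>. \<exists>C. \<forall>x. norm (mi_power x \<alpha> * mi_deriv \<beta> f x) \<le> C)}"

definition gs_bound ::
    "real \<Rightarrow> real \<Rightarrow> real \<Rightarrow> real \<Rightarrow> ('a::euclidean_space \<Rightarrow> complex) \<Rightarrow> bool"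
  where "gs_bound s A B c f \<longleftrightarrow> (\<forall>x \<alpha> \<beta>. norm (mi_power x \<alpha> * mi_deriv \<beta> f x)
    \<le> c * A ^ mi_abs \<alpha> * B ^ mi_abs \<beta> * mi_fact \<alpha> powr s * mi_fact \<beta> powr s)"

definition gelfand_shilov :: "real \<Rightarrow> ('a::euclidean_space \<Rightarrow> complex) set"
  where "gelfand_shilov s = {f \<in> schwartz. \<exists>A>0. \<exists>B>0. \<exists>c>0. gs_bound s A B c f}"

text \<open>Since the brackets extend \<open>\<langle>f, h\<rangle> = \<integral> f * cnj h\<close>, a distribution \<open>u\<close> is represented by the
  conjugate-linear functional \<open>\<langle>u, _\<rangle>\<close>. The space carries the inductive limit topology of the
  normed spaces obtained by fixing \<open>A\<close> and \<open>B\<close>, with norm the least admissible \<open>c\<close>; continuity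
  means boundedness on each of these. Values off the test function space are irrelevant.\<close>

definition gs_dual :: "real \<Rightarrow> (('a::euclidean_space \<Rightarrow> complex) \<Rightarrow> complex) set"
  where "gs_dual s = {u.
    (\<forall>f\<in>gelfand_shilov s. \<forall>h\<in>gelfand_shilov s. u (\<lambda>x. f x + h x) = u f + u h) \<and>
    (\<forall>f\<in>gelfand_shilov s. \<forall>k. u (\<lambda>x. k * f x) = cnj k * u f) \<and>
    (\<forall>A>0. \<forall>B>0. \<exists>M. \<forall>f\<in>gelfand_shilov s. \<forall>c\<ge>0. gs_bound s A B c f \<longrightarrow> norm (u f) \<le> M * c)}"

definition L2 :: "('a::euclidean_space \<Rightarrow> complex) set"
  where "L2 = {f \<in> borel_measurable lebesgue. integrable lebesgue (\<lambda>x. (norm (f x))\<^sup>2)}"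

definition L2_normsq :: "('a::euclidean_space \<Rightarrow> complex) \<Rightarrow> real"
  where "L2_normsq f = (LINT x|lebesgue. (norm (f x))\<^sup>2)"

definition L2_inner :: "('a::euclidean_space \<Rightarrow> complex) \<Rightarrow> ('a \<Rightarrow> complex) \<Rightarrow> complex"
  where "L2_inner f h = (LINT x|lebesgue. f x * cnj (h x))"

definition tf_shift :: "'a::euclidean_space \<times> 'a \<Rightarrow> ('a \<Rightarrow> complex) \<Rightarrow> 'a \<Rightarrow> complex"
  where "tf_shift z f = (\<lambda>t. case z of (x, \<xi>) \<Rightarrow> cis (2 * pi * (\<xi> \<bullet> t)) * f (t - x))"

definition is_lattice :: "'a::euclidean_space set \<Rightarrow> bool"
  where "is_lattice \<Lambda> \<longleftrightarrow>
    (\<exists>A :: 'a \<Rightarrow> 'a. linear A \<and> bij A \<and> \<Lambda> = A ` {k. \<forall>b\<in>Basis. k \<bullet> b \<in> \<int>})"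

definition gabor_frame :: "('a::euclidean_space \<Rightarrow> complex) \<Rightarrow> ('a \<times> 'a) set \<Rightarrow> bool"
  where "gabor_frame g \<Lambda> \<longleftrightarrow> is_lattice \<Lambda> \<and> g \<in> L2 \<and> \<not> (AE x in lebesgue. g x = 0) \<and>
    (\<exists>A>0. \<exists>B>0. \<forall>f\<in>L2.
      (\<lambda>z. (norm (L2_inner f (tf_shift z g)))\<^sup>2) summable_on \<Lambda> \<and>
      A * L2_normsq f \<le> (\<Sum>\<^sub>\<infinity>z\<in>\<Lambda>. (norm (L2_inner f (tf_shift z g)))\<^sup>2) \<and>
      (\<Sum>\<^sub>\<infinity>z\<in>\<Lambda>. (norm (L2_inner f (tf_shift z g)))\<^sup>2) \<le> B * L2_normsq f)"

definition wigner ::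
    "('a::euclidean_space \<Rightarrow> complex) \<Rightarrow> ('a \<Rightarrow> complex) \<Rightarrow> 'a \<times> 'a \<Rightarrow> complex"
  where "wigner f h = (\<lambda>(x, \<xi>). LINT t|lebesgue.
    f (x + (1/2) *\<^sub>R t) * cnj (h (x - (1/2) *\<^sub>R t)) * cis (- (2 * pi * (t \<bullet> \<xi>))))"

text \<open>The distribution \<open>\<sigma>\<^sup>w f\<close>, again as the functional \<open>h \<mapsto> \<langle>\<sigma>\<^sup>w f, h\<rangle>\<close>.\<close>

definition weyl_op ::
    "(('a::euclidean_space \<times> 'a \<Rightarrow> complex) \<Rightarrow> complex) \<Rightarrow>
     ('a \<Rightarrow> complex) \<Rightarrow> ('a \<Rightarrow> complex) \<Rightarrow> complex"
  where "weyl_op \<sigma> f = (\<lambda>h. \<sigma> (wigner h f))"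

text \<open>Row index first: the entry \<open>\<langle>\<sigma>\<^sup>w \<pi>(w) g, \<pi>(z) g\<rangle>\<close> is in row \<open>z\<close> and column \<open>w\<close>.\<close>

definition gabor_matrix ::
    "(('a::euclidean_space \<times> 'a \<Rightarrow> complex) \<Rightarrow> complex) \<Rightarrow> ('a \<Rightarrow> complex) \<Rightarrow>
     'a \<times> 'a \<Rightarrow> 'a \<times> 'a \<Rightarrow> complex"
  where "gabor_matrix \<sigma> g z w = weyl_op \<sigma> (tf_shift w g) (tf_shift z g)"

text \<open>The \<open>n\<close>-th term (\<open>n \<ge> 1\<close>) of the non-increasing rearrangement of \<open>(\<bar>a i\<bar>)\<close>, \<open>i \<in> I\<close>,
  via the distribution function. If the nonzero entries can be listed in order of
  non-increasing modulus (possibly together with some zeros), it is the \<open>n\<close>-th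
  one in the list, as shown below.\<close>

definition rearrangement :: "'i set \<Rightarrow> ('i \<Rightarrow> complex) \<Rightarrow> nat \<Rightarrow> real"
  where "rearrangement I a n =
    Inf {t. 0 \<le> t \<and> finite {i\<in>I. t < norm (a i)} \<and> card {i\<in>I. t < norm (a i)} < n}"

lemma rearrangement_eq_nth_entry:
  assumes inj: "inj_on e {1..}" and sub: "e ` {1..} \<subseteq> I"
    and zero: "\<And>i. i \<in> I - e ` {1..} \<Longrightarrow> a i = 0"
    and mono: "\<And>m n. 1 \<le> m \<Longrightarrow> m \<le> n \<Longrightarrow> norm (a (e n)) \<le> norm (a (e m))"
    and n: "1 \<le> (n::nat)"
  shows "rearrangement I a n = norm (a (e n))"
  unfolding rearrangement_def
proof (rule cInf_eq_minimum)
  let ?S = "{i\<in>I. norm (a (e n)) < norm (a i)}"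
  have S: "?S \<subseteq> e ` {1..<n}"
  proof
    fix i assume i: "i \<in> ?S"
    then have iI: "i \<in> I" and less: "norm (a (e n)) < norm (a i)" by auto
    have "a i \<noteq> 0" using less norm_ge_zero[of "a (e n)"] by (auto simp del: norm_ge_zero)
    with zero iI have "i \<in> e ` {1..}" by blast
    then obtain m where m: "m \<ge> 1" "i = e m" by auto
    have "m < n"
    proof (rule ccontr)
      assume "\<not> m < n"
      with mono[OF n, of m] less m(2) show False by simp
    qed
    with m show "i \<in> e ` {1..<n}" by auto
  qed
  then have "card ?S \<le> card (e ` {1..<n})" by (rule card_mono[rotated]) simp
  also have "\<dots> \<le> card {1..<n}" by (rule card_image_le) simp
  also have "\<dots> < n" using n by simp
  finally have "card ?S < n" .
  moreover have "finite ?S" using S by (rule finite_subset) simp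
  ultimately show "norm (a (e n)) \<in> {t. 0 \<le> t \<and> finite {i\<in>I. t < norm (a i)} \<and>
      card {i\<in>I. t < norm (a i)} < n}"
    by simp
next
  fix t assume "t \<in> {t. 0 \<le> t \<and> finite {i\<in>I. t < norm (a i)} \<and> card {i\<in>I. t < norm (a i)} < n}"
  then have t: "finite {i\<in>I. t < norm (a i)}" "card {i\<in>I. t < norm (a i)} < n" by auto
  show "norm (a (e n)) \<le> t"
  proof (rule ccontr)
    assume "\<not> norm (a (e n)) \<le> t"
    then have "t < norm (a (e m))" if "1 \<le> m" "m \<le> n" for m
      using mono[OF that] by linarith
    then have "e ` {1..n} \<subseteq> {i\<in>I. t < norm (a i)}" using sub by auto
    then have "card (e ` {1..n}) \<le> card {i\<in>I. t < norm (a i)}" by (rule card_mono[OF t(1)])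
    moreover have "card (e ` {1..n}) = n"
      using card_image[OF inj_on_subset[OF inj, of "{1..n}"]] by auto
    ultimately show False using t(2) by simp
  qed
qed

end

(*
  At most (K max(1,R))^(2d) lattice points lie within distance R of a given one, so with
  R = n^(1/(2d)) / (2K) fewer than n entries of a column or row belong to such points; by the
  off-diagonal decay all other entries are at most C0 exp(-e0 R^(1/s)).
*)

theory Submission
  imports Defs
begin

text \<open>Each coordinate of \<open>k - l\<close> is an integer of modulus at most
  \<open>r\<close>, because a coordinate never exceeds the norm. So \<open>S\<close> embeds into a
  box with 2 floor(r) + 1 integer values per coordinate.\<close>

lemma card_integer_points_near:
  fixes l :: "'a::euclidean_space"
  assumes l: "\<forall>b\<in>Basis. l \<bullet> b \<in> \<int>" and r: "r \<ge> 0"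
  defines "S \<equiv> {k. (\<forall>b\<in>Basis. k \<bullet> b \<in> \<int>) \<and> norm (k - l) \<le> r}"
  shows "finite S" and "real (card S) \<le> (2 * r + 1) ^ DIM('a)"
proof -
  \<comment> \<open>The floor only changes the type, since these coordinates are already integers
    for \<open>k \<in> S\<close>. Restricting to \<open>Basis\<close> makes \<open>F k\<close>
    extensional, so that it lies in the finite product \<open>P\<close>.\<close>
  define F where "F k = (\<lambda>b\<in>Basis. \<lfloor>(k - l) \<bullet> b\<rfloor>)" for k :: 'a
  define P where "P = (Basis :: 'a set) \<rightarrow>\<^sub>E {- \<lfloor>r\<rfloor>..\<lfloor>r\<rfloor>}"
  have int: "of_int (F k b) = (k - l) \<bullet> b" if "k \<in> S" "b \<in> Basis" for k b
  proof -
    have "(k - l) \<bullet> b \<in> \<int>" using that l by (auto simp: S_def inner_diff_left)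
    then show ?thesis using that(2) by (auto simp: F_def elim: Ints_cases)
  qed
  have FP: "F ` S \<subseteq> P"
  proof
    fix f assume "f \<in> F ` S"
    then obtain k where k: "k \<in> S" "f = F k" by auto
    have "F k b \<in> {- \<lfloor>r\<rfloor>..\<lfloor>r\<rfloor>}" if b: "b \<in> Basis" for b
    proof -
      have "\<bar>(k - l) \<bullet> b\<bar> \<le> r"
        using Basis_le_norm[OF b, of "k - l"] k by (auto simp: S_def)
      then have "\<bar>of_int (F k b)\<bar> \<le> r" using int[OF k(1) b] by simp
      then have "F k b \<le> \<lfloor>r\<rfloor>" "- F k b \<le> \<lfloor>r\<rfloor>" by (auto simp: le_floor_iff)
      then show ?thesis by auto
    qed
    then show "f \<in> P" using k by (auto simp: P_def F_def)
  qed
  have inj: "inj_on F S"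
  proof (rule inj_onI)
    fix k k' assume k: "k \<in> S" "k' \<in> S" "F k = F k'"
    have "k \<bullet> b = k' \<bullet> b" if "b \<in> Basis" for b
      using int[OF k(1) that] int[OF k(2) that] k(3) by (simp add: inner_diff_left)
    then show "k = k'" by (rule euclidean_eqI)
  qed
  have finP: "finite P" unfolding P_def by (intro finite_PiE) auto
  show "finite S" using finite_imageD[OF finite_subset[OF FP finP] inj] .
  have "card S \<le> card P" using card_image[OF inj] card_mono[OF finP FP] by simp
  also have "card P = nat (2 * \<lfloor>r\<rfloor> + 1) ^ DIM('a)" by (simp add: P_def card_PiE)
  finally have "real (card S) \<le> real (nat (2 * \<lfloor>r\<rfloor> + 1)) ^ DIM('a)"
    by (metis of_nat_le_iff of_nat_power)
  also have "\<dots> \<le> (2 * r + 1) ^ DIM('a)"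
    using r of_int_floor_le[of r] by (intro power_mono) auto
  finally show "real (card S) \<le> (2 * r + 1) ^ DIM('a)" .
qed

text \<open>An invertible linear map is bounded below, so lattice points near \<open>A l\<close>
  come from integer points near \<open>l\<close>. The constant \<open>K\<close> is the same for all
  centres \<open>w\<close>; this later makes one pair of constants serve all rows and
  columns.\<close>

lemma lattice_card_near_le:
  fixes \<Lambda> :: "'a::euclidean_space set"
  assumes "is_lattice \<Lambda>"
  obtains K where "K > 0"
    and "\<And>w R. w \<in> \<Lambda> \<Longrightarrow> finite {z\<in>\<Lambda>. norm (z - w) \<le> R}"
    and "\<And>w R. w \<in> \<Lambda> \<Longrightarrow> real (card {z\<in>\<Lambda>. norm (z - w) \<le> R}) \<le> (K * max 1 R) ^ DIM('a)"
proof -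
  obtain A :: "'a \<Rightarrow> 'a" where A: "linear A" "bij A"
    and \<Lambda>: "\<Lambda> = A ` {k. \<forall>b\<in>Basis. k \<bullet> b \<in> \<int>}"
    using assms unfolding is_lattice_def by blast
  obtain B where B: "B > 0" "\<And>x. B * norm x \<le> norm (A x)"
    using linear_inj_bounded_below_pos[OF A(1)] A(2) by (metis bij_is_inj mult.commute)
  \<comment> \<open>Chosen so that 2 M / B + 1 \<le> K M for every M \<ge> 1, applied with M =
    \<open>max 1 R\<close>.\<close>
  define K where "K = 2 / B + 1"
  have "finite {z\<in>\<Lambda>. norm (z - w) \<le> R} \<and>
      real (card {z\<in>\<Lambda>. norm (z - w) \<le> R}) \<le> (K * max 1 R) ^ DIM('a)" if w: "w \<in> \<Lambda>" for w R
  proof -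
    \<comment> \<open>The maximum keeps the radius nonnegative even when \<open>R\<close> is
      negative.\<close>
    define r where "r = max 1 R / B"
    have r: "r \<ge> 0" using B by (simp add: r_def)
    obtain l where l: "\<forall>b\<in>Basis. l \<bullet> b \<in> \<int>" "w = A l" using w unfolding \<Lambda> by blast
    let ?S = "{k. (\<forall>b\<in>Basis. k \<bullet> b \<in> \<int>) \<and> norm (k - l) \<le> r}"
    have sub: "{z\<in>\<Lambda>. norm (z - w) \<le> R} \<subseteq> A ` ?S"
    proof
      fix z assume "z \<in> {z\<in>\<Lambda>. norm (z - w) \<le> R}"
      then obtain k where k: "\<forall>b\<in>Basis. k \<bullet> b \<in> \<int>" "z = A k" "norm (z - w) \<le> R"
        using \<Lambda> by auto
      have "B * norm (k - l) \<le> R"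
        using B(2)[of "k - l"] k l by (simp add: linear_diff[OF A(1)])
      then have "norm (k - l) \<le> r" using B(1) by (simp add: r_def field_simps)
      then show "z \<in> A ` ?S" using k by auto
    qed
    have fin: "finite (A ` ?S)" using card_integer_points_near(1)[OF l(1) r] by simp
    have "card {z\<in>\<Lambda>. norm (z - w) \<le> R} \<le> card ?S"
      using card_mono[OF fin sub] card_image_le[OF card_integer_points_near(1)[OF l(1) r], of A]
      by simp
    then have "real (card {z\<in>\<Lambda>. norm (z - w) \<le> R}) \<le> (2 * r + 1) ^ DIM('a)"
      using card_integer_points_near(2)[OF l(1) r] by linarith
    also have "\<dots> \<le> (K * max 1 R) ^ DIM('a)"
      using r by (intro power_mono) (auto simp: K_def r_def algebra_simps)
    finally show ?thesis using finite_subset[OF sub fin] by blast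
  qed
  moreover have "K > 0" using B by (simp add: K_def add_pos_pos)
  ultimately show thesis using that by blast
qed

lemma rearrangement_le:
  assumes "0 \<le> t" "finite {i\<in>I. t < norm (a i)}" "card {i\<in>I. t < norm (a i)} < n"
  shows "rearrangement I a n \<le> t"
  unfolding rearrangement_def using assms by (intro cInf_lower bdd_belowI[of _ 0]) auto

text \<open>Here \<open>\<rho>\<close> stands for the distance to a fixed lattice point and
  \<open>N\<close> for the dimension, so that rows and columns are treated alike. The factor
  \<open>exp e\<close> pays for the small \<open>n\<close>, where the counting bound is too
  weak.\<close>

lemma rearrangement_exp_decay:
  assumes s: "s > 0" and N: "N > 0" and K: "K > 0" and C: "C > 0" and e: "e > 0"
    and fin: "\<And>R. finite {i\<in>I. \<rho> i \<le> R}"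
    and card: "\<And>R. real (card {i\<in>I. \<rho> i \<le> R}) \<le> (K * max 1 R) ^ N"
    and decay: "\<And>i. i \<in> I \<Longrightarrow> norm (a i) \<le> C * exp (- e * \<rho> i powr (1 / s))"
    and n: "n \<ge> 1"
  shows "rearrangement I a n
    \<le> C * exp e * exp (- (e / (2 * K) powr (1 / s)) * real n powr (1 / (real N * s)))"
proof -
  define m where "m = real n powr (1 / real N)"
  have m: "m > 0" "m ^ N = real n" using n N by (simp_all add: m_def powr_power)
  \<comment> \<open>The factor 2 turns the counting bound for R > 1 into \<open>(m / 2) ^ N\<close>,
    strictly below \<open>m ^ N\<close>, which is \<open>n\<close>; the rearrangement needs strictly
    fewer than \<open>n\<close> large entries.\<close>
  define R where "R = m / (2 * K)"
  have R: "R > 0" using m K by (simp add: R_def)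
  have "R powr (1 / s) = real n powr (1 / (real N * s)) / (2 * K) powr (1 / s)"
    using m K by (simp add: R_def powr_divide) (simp add: m_def powr_powr)
  then have rhs: "C * exp e * exp (- (e / (2 * K) powr (1 / s)) * real n powr (1 / (real N * s)))
      = C * exp (e - e * R powr (1 / s))"
    by (simp add: mult.assoc flip: exp_add)
  show ?thesis
  proof (cases "R \<le> 1")
    case True
    \<comment> \<open>For R \<le> 1 the counting bound is only \<open>K ^ N\<close>, which may
      exceed \<open>n\<close>. The uniform bound \<open>C\<close> suffices, as the exponent in the
      target is then nonnegative.\<close>
    have "norm (a i) \<le> C" if "i \<in> I" for i
    proof -
      have "C * exp (- e * \<rho> i powr (1 / s)) \<le> C * 1" using C e by (intro mult_left_mono) auto
      then show ?thesis using decay[OF that] by simp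
    qed
    then have empty: "{i\<in>I. C < norm (a i)} = {}" by force
    have "rearrangement I a n \<le> C" using C n by (intro rearrangement_le) (simp_all add: empty)
    also have "C * 1 \<le> C * exp (e - e * R powr (1 / s))"
      using C e R s True by (intro mult_left_mono) (auto simp: powr_le1)
    finally show ?thesis unfolding rhs by simp
  next
    case False
    \<comment> \<open>This is the decay bound at distance \<open>R\<close>; by monotonicity any
      entry exceeding it has \<rho> \<le> R.\<close>
    define t where "t = C * exp (- e * R powr (1 / s))"
    have sub: "{i\<in>I. t < norm (a i)} \<subseteq> {i\<in>I. \<rho> i \<le> R}"
    proof (rule ccontr)
      assume "\<not> ?thesis"
      then obtain i where i: "i \<in> I" "t < norm (a i)" "R < \<rho> i" by force
      have "R powr (1 / s) \<le> \<rho> i powr (1 / s)" using i R s by (intro powr_mono2) auto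
      then have "C * exp (- e * \<rho> i powr (1 / s)) \<le> t" using C e by (simp add: t_def)
      then show False using decay[OF i(1)] i by linarith
    qed
    have "real (card {i\<in>I. t < norm (a i)}) \<le> real (card {i\<in>I. \<rho> i \<le> R})"
      using card_mono[OF fin sub] by simp
    also have "\<dots> \<le> (K * max 1 R) ^ N" by (rule card)
    also have "K * max 1 R = m / 2" using False K by (simp add: R_def max_def)
    also have "(m / 2) ^ N < m ^ N" using m N by (intro power_strict_mono) auto
    finally have "card {i\<in>I. t < norm (a i)} < n" using m by simp
    then have "rearrangement I a n \<le> t"
      using C finite_subset[OF sub fin] by (intro rearrangement_le) (simp_all add: t_def)
    also have "t \<le> C * exp (e - e * R powr (1 / s))" using C e by (simp add: t_def)
    finally show ?thesis unfolding rhs .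
  qed
qed

theorem proposition4p5:
  fixes s C\<^sub>0 \<epsilon>\<^sub>0 :: real
    and g :: "real ^ 'd \<Rightarrow> complex"
    and \<Lambda> :: "((real ^ 'd) \<times> (real ^ 'd)) set"
    and \<sigma> :: "((real ^ 'd) \<times> (real ^ 'd) \<Rightarrow> complex) \<Rightarrow> complex"
  assumes "s \<ge> 1/2"
    and "gabor_frame g \<Lambda>"
    and "g \<in> gelfand_shilov s"
    and "\<sigma> \<in> gs_dual s"
    and "C\<^sub>0 > 0" and "\<epsilon>\<^sub>0 > 0"
    and "\<And>z w. z \<in> \<Lambda> \<Longrightarrow> w \<in> \<Lambda> \<Longrightarrow>
      norm (gabor_matrix \<sigma> g z w) \<le> C\<^sub>0 * exp (- \<epsilon>\<^sub>0 * norm (z - w) powr (1 / s))"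
  shows "\<exists>C>0. \<exists>\<epsilon>>0.
    \<forall>a \<in> {(\<lambda>z. gabor_matrix \<sigma> g z w) |w. w \<in> \<Lambda>} \<union> {(\<lambda>w. gabor_matrix \<sigma> g z w) |z. z \<in> \<Lambda>}.
    \<forall>n\<ge>1. rearrangement \<Lambda> a n
      \<le> C * exp (- \<epsilon> * real n powr (1 / (2 * real CARD('d) * s)))"
proof -
  have s: "s > 0" using assms(1) by simp
  obtain K where K: "K > 0"
    and fin: "\<And>w R. w \<in> \<Lambda> \<Longrightarrow> finite {z\<in>\<Lambda>. norm (z - w) \<le> R}"
    and card: "\<And>w R. w \<in> \<Lambda> \<Longrightarrow> real (card {z\<in>\<Lambda>. norm (z - w) \<le> R})
      \<le> (K * max 1 R) ^ DIM((real ^ 'd) \<times> (real ^ 'd))"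
    using lattice_card_near_le[of \<Lambda>] assms(2) unfolding gabor_frame_def by blast
  define \<epsilon> where "\<epsilon> = \<epsilon>\<^sub>0 / (2 * K) powr (1 / s)"
  \<comment> \<open>Phase space has twice the dimension of configuration space, whence the 2d in the
    exponent.\<close>
  have dim: "DIM((real ^ 'd) \<times> (real ^ 'd)) = 2 * CARD('d)" by simp
  \<comment> \<open>The point \<open>p\<close> is the fixed index: the column index for a column,
    the row index for a row. The constants do not depend on it.\<close>
  have bound: "rearrangement \<Lambda> a n
      \<le> C\<^sub>0 * exp \<epsilon>\<^sub>0 * exp (- \<epsilon> * real n powr (1 / (2 * real CARD('d) * s)))"
    if "p \<in> \<Lambda>" "n \<ge> 1"
      and "\<And>z. z \<in> \<Lambda> \<Longrightarrow> norm (a z) \<le> C\<^sub>0 * exp (- \<epsilon>\<^sub>0 * norm (z - p) powr (1 / s))"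
    for a p n
    using rearrangement_exp_decay[OF s _ K assms(5,6) fin[OF that(1)] card[OF that(1)] that(3,2)]
    unfolding dim \<epsilon>_def by simp
  have "rearrangement \<Lambda> a n
      \<le> C\<^sub>0 * exp \<epsilon>\<^sub>0 * exp (- \<epsilon> * real n powr (1 / (2 * real CARD('d) * s)))"
    if a: "a \<in> {(\<lambda>z. gabor_matrix \<sigma> g z w) |w. w \<in> \<Lambda>} \<union> {(\<lambda>w. gabor_matrix \<sigma> g z w) |z. z \<in> \<Lambda>}"
      and n: "n \<ge> 1" for a n
    using a
  proof (elim UnE CollectE exE conjE)
    fix w assume "a = (\<lambda>z. gabor_matrix \<sigma> g z w)" "w \<in> \<Lambda>"
    then show ?thesis using bound[of w n a] n assms(7) by auto
  next
    fix z assume "a = (\<lambda>w. gabor_matrix \<sigma> g z w)" "z \<in> \<Lambda>"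
    \<comment> \<open>In a row the running index is the second one, so the symmetry of the distance
      is used.\<close>
    then show ?thesis using bound[of z n a] n assms(7)[of z] by (auto simp: norm_minus_commute)
  qed
  moreover have "C\<^sub>0 * exp \<epsilon>\<^sub>0 > 0" "\<epsilon> > 0" using assms(5,6) K by (auto simp: \<epsilon>_def)
  ultimately show ?thesis by blast
qed

end
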